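(* Suppose $(\lambda,\mu)\in{\sf Kostka}_r^{\mathbb Z}$. Then $(\lambda,\mu)$ lies on an extremal ray of ${\sf Kostka}_r$ if and only if it is a positive rational multiple of $$\Big(\underbrace{a,\ldots,a}_{b+\ell},0,\ldots,0;\ \underbrace{a,\ldots,a}_{\ell},\underbrace{b,\ldots,b}_{a},0,\ldots,0\Big)\in\mathbb{R}^{2r}$$ for some integers $a,b,\ell$ with $r\ge a+\ell\ge a\ge b>0$.
   Context: Fix a positive integer $r$. ${\sf Kostka}_r$ is the polyhedral cone of $(\lambda,\mu)\in\mathbb{R}^{2r}$ (written $(\lambda_1,\ldots,\lambda_r;\mu_1,\ldots,\mu_r)$) with $\lambda_1\ge\cdots\ge\lambda_r\ge0$, $\mu_1\ge\cdots\ge\mu_r\ge0$, $\sum_{i=1}^t\lambda_i\ge\sum_{i=1}^t\mu_i$ for $1\le t\le r-1$, and $\sum_{i=1}^r\lambda_i=\sum_{i=1}^r\mu_i$; ${\sf Kostka}_r^{\mathbb Z}={\sf Kostka}_r\cap\mathbb{Z}^{2r}$. An extremal ray is a one-dimensional face of ${\sf Kostka}_r$.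
   Formalization: "Lies on an extremal ray" is read as lying on the ray away from the origin, since (0;0) lies in every one-dimensional face of the cone but is not a positive multiple of any of the listed vectors. *)

theory Defs
  imports "HOL-Analysis.Analysis"
begin

text \<open>
  The parameter r is \<open>CARD('n)\<close> for an arbitrary finite linearly ordered type \<open>'n\<close>; the order on
  \<open>'n\<close> is the order of the coordinates, and \<open>position i\<close> is the 1-based place of coordinate i.
  The ambient space \<open>\<real>\<^sup>2\<^sup>r\<close> is \<open>(real ^ 'n) \<times> (real ^ 'n)\<close>.
\<close>

definition position :: "'n::{finite,linorder} \<Rightarrow> nat" where
  "position i = card {..i}"

lemma strict_mono_position: "strict_mono (position :: 'n::{finite,linorder} \<Rightarrow> nat)"
  unfolding position_def by (intro strict_monoI psubset_card_mono) auto

lemma bij_betw_position: "bij_betw position (UNIV :: 'n::{finite,linorder} set) {1..CARD('n)}"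
proof -
  have inj: "inj (position :: 'n \<Rightarrow> nat)"
    using strict_mono_position by (rule strict_mono_imp_inj_on)
  have "position i \<in> {1..CARD('n)}" for i :: 'n
  proof -
    have "0 < card {..i}" by (subst card_gt_0_iff) auto
    moreover have "card {..i} \<le> CARD('n)" by (rule card_mono) auto
    ultimately show ?thesis by (simp add: position_def)
  qed
  then have "range (position :: 'n \<Rightarrow> nat) \<subseteq> {1..CARD('n)}" by auto
  then have "range (position :: 'n \<Rightarrow> nat) = {1..CARD('n)}"
    by (rule card_subset_eq[rotated]) (simp_all add: card_image[OF inj])
  with inj show ?thesis by (simp add: bij_betw_def)
qed

definition Kostka :: "((real ^ 'n::{finite,linorder}) \<times> (real ^ 'n::{finite,linorder})) set" where
  "Kostka = {(lam, mu).
     (\<forall>i j. i \<le> j \<longrightarrow> lam $ i \<ge> lam $ j) \<and> (\<forall>i. lam $ i \<ge> 0) \<and>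
     (\<forall>i j. i \<le> j \<longrightarrow> mu $ i \<ge> mu $ j) \<and> (\<forall>i. mu $ i \<ge> 0) \<and>
     (\<forall>t\<in>{1..CARD('n) - 1}. (\<Sum>i | position i \<le> t. lam $ i) \<ge> (\<Sum>i | position i \<le> t. mu $ i)) \<and>
     (\<Sum>i\<in>UNIV. lam $ i) = (\<Sum>i\<in>UNIV. mu $ i)}"

definition Kostka_int :: "((real ^ 'n::{finite,linorder}) \<times> (real ^ 'n::{finite,linorder})) set" where
  "Kostka_int = Kostka \<inter> {(lam, mu). \<forall>i. lam $ i \<in> \<int> \<and> mu $ i \<in> \<int>}"

text \<open>
  A one-dimensional face contains the apex 0 of the cone, so lying on an extremal ray in the sense of
  spanning it is membership in \<open>F - {0}\<close>.
\<close>

definition extremal_ray :: "((real ^ 'n::{finite,linorder}) \<times> (real ^ 'n::{finite,linorder})) set \<Rightarrow> bool" where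
  "extremal_ray F \<longleftrightarrow> F face_of Kostka \<and> aff_dim F = 1"

definition ray_generator ::
    "int \<Rightarrow> int \<Rightarrow> int \<Rightarrow> (real ^ 'n::{finite,linorder}) \<times> (real ^ 'n::{finite,linorder})" where
  "ray_generator a b l =
     ((\<chi> i. if int (position i) \<le> b + l then of_int a else 0),
      (\<chi> i. if int (position i) \<le> l then of_int a
            else if int (position i) \<le> l + a then of_int b else 0))"

end

theory Submission
  imports Defs
begin

text \<open>
  Write \<open>D t\<close> for the difference of the \<open>t\<close>-th partial sums of \<open>lam\<close> and \<open>mu\<close>. If \<open>k\<close> is a descent
  of \<open>lam\<close>, let \<open>l < k \<le> m\<close> be the closest descents of \<open>mu\<close> around it (\<open>l = 0\<close> if there is none
  before \<open>k\<close>). On \<open>[l, m]\<close> the function \<open>D\<close> is concave and nonnegative, so if it vanished strictly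
  inside it would vanish throughout, contradicting the descent of \<open>lam\<close> at \<open>k\<close> when \<open>k < m\<close>. Hence
  every inequality that is tight for \<open>(lam, mu)\<close> is tight for the generator with parameters
  \<open>a = m - l\<close> and \<open>b = k - l\<close>, and a small multiple of it can be split off inside the cone. On an
  extremal ray this forces proportionality. Conversely, the inequalities tight for a generator
  determine it up to a scalar.
\<close>

section \<open>Coordinates indexed by natural numbers\<close>

text \<open>The sum has at most one term; it is empty, with value 0, when \<open>t\<close> is not in \<open>{1..CARD('n)}\<close>.\<close>

definition coord :: "real ^ 'n::{finite,linorder} \<Rightarrow> nat \<Rightarrow> real" where
  "coord v t = (\<Sum>i | position i = t. v $ i)"

lemma position_eq_iff: "position i = position j \<longleftrightarrow> i = (j :: 'n::{finite,linorder})"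
  using strict_mono_imp_inj_on[OF strict_mono_position] by (auto dest: injD)

lemma position_le_iff: "position i \<le> position j \<longleftrightarrow> i \<le> (j :: 'n::{finite,linorder})"
  by (rule strict_mono_less_eq[OF strict_mono_position])

lemma position_range: "position (i :: 'n::{finite,linorder}) \<in> {1..CARD('n)}"
  using bij_betw_position bij_betwE by blast

lemma ex_position:
  assumes "t \<in> {1..CARD('n)}"
  obtains i :: "'n::{finite,linorder}" where "position i = t"
  using assms bij_betw_imp_surj_on[OF bij_betw_position[where 'n='n]] by (metis imageE)

lemma coord_position [simp]: "coord v (position i) = v $ i"
  by (simp add: coord_def position_eq_iff)

lemma coord_outside: "t \<notin> {1..CARD('n)} \<Longrightarrow> coord (v :: real ^ 'n::{finite,linorder}) t = 0"
  unfolding coord_def using position_range by (intro sum.neutral) blast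

lemma coord_add [simp]: "coord (u + v) t = coord u t + coord v t"
  by (simp add: coord_def sum.distrib)

lemma coord_diff [simp]: "coord (u - v) t = coord u t - coord v t"
  by (simp add: coord_def sum_subtractf)

lemma coord_scaleR [simp]: "coord (c *\<^sub>R u) t = c * coord u t"
  by (simp add: coord_def sum_distrib_left)

lemma coord_zero [simp]: "coord 0 t = 0"
  by (simp add: coord_def)

lemma coord_eqI:
  fixes u v :: "real ^ 'n::{finite,linorder}"
  assumes "\<And>t. 1 \<le> t \<Longrightarrow> t \<le> CARD('n) \<Longrightarrow> coord u t = coord v t"
  shows "u = v"
proof -
  have "u $ i = v $ i" for i
    using assms[of "position i"] position_range[of i] by auto
  then show ?thesis by (simp add: vec_eq_iff)
qed

lemma sum_coord: "(\<Sum>s=1..t. coord v s) = (\<Sum>i | position i \<le> t. v $ i)"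
proof -
  have "(\<Sum>s=1..t. coord v s) = (\<Sum>s=1..t. \<Sum>i\<in>{i \<in> {i. position i \<le> t}. position i = s}. v $ i)"
    unfolding coord_def by (intro sum.cong) auto
  also have "\<dots> = (\<Sum>i | position i \<le> t. v $ i)"
    using position_range by (intro sum.group) fastforce+
  finally show ?thesis .
qed

lemma sum_coord_UNIV:
  "CARD('n) \<le> t \<Longrightarrow> (\<Sum>s=1..t. coord v s) = (\<Sum>i\<in>UNIV. (v :: real ^ 'n::{finite,linorder}) $ i)"
proof -
  assume t: "CARD('n) \<le> t"
  have "position i \<le> t" for i :: 'n
    using position_range[of i] t by simp
  then have "{i :: 'n. position i \<le> t} = UNIV" by blast
  then show "(\<Sum>s=1..t. coord v s) = (\<Sum>i\<in>UNIV. v $ i)" unfolding sum_coord by simp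
qed

section \<open>Monotone and constant stretches of coordinate sequences\<close>

lemma antimono_seqD:
  fixes f :: "nat \<Rightarrow> real"
  assumes "\<And>t. p \<le> t \<Longrightarrow> t < q \<Longrightarrow> f (Suc t) \<le> f t" and "p \<le> s" "s \<le> t" "t \<le> q"
  shows "f t \<le> f s"
  using assms(3,4)
proof (induction t rule: dec_induct)
  case (step n)
  then show ?case using assms(1)[of n] \<open>p \<le> s\<close> by force
qed simp

lemma const_seqD:
  fixes f :: "nat \<Rightarrow> real"
  assumes "\<And>t. p \<le> t \<Longrightarrow> t < q \<Longrightarrow> f t = f (Suc t)" and "p \<le> t" "t \<le> q"
  shows "f t = f p"
  using assms(2,3)
proof (induction t rule: dec_induct)
  case (step n)
  then show ?case using assms(1)[of n] by force
qed simp

text \<open>Positions past \<open>CARD('n)\<close> carry the default value 0, and a sequence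
  constant from \<open>t\<close> onward reaches them.\<close>

lemma coord_eq_0I:
  fixes v :: "real ^ 'n::{finite,linorder}"
  assumes "\<And>s. t \<le> s \<Longrightarrow> coord v s = coord v (Suc s)"
  shows "coord v t = 0"
proof -
  have "coord v (t + Suc CARD('n)) = coord v t"
    by (rule const_seqD[of t "t + Suc CARD('n)"]) (erule assms, simp_all)
  then show ?thesis using coord_outside[of "t + Suc CARD('n)" v] by simp
qed

text \<open>The default value 0 at position \<open>Suc CARD('n)\<close> turns the last consecutive
  inequality into nonnegativity of the smallest coordinate, so one family of inequalities expresses
  both conditions.\<close>

lemma coord_antimono_iff:
  fixes v :: "real ^ 'n::{finite,linorder}"
  shows "(\<forall>i j. i \<le> j \<longrightarrow> v $ i \<ge> v $ j) \<and> (\<forall>i. v $ i \<ge> 0) \<longleftrightarrow>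
    (\<forall>t\<in>{1..CARD('n)}. coord v (Suc t) \<le> coord v t)" (is "?L \<longleftrightarrow> ?R")
proof
  assume L: ?L
  show ?R
  proof
    fix t assume t: "t \<in> {1..CARD('n)}"
    obtain i :: 'n where i: "position i = t" using ex_position[OF t] .
    show "coord v (Suc t) \<le> coord v t"
    proof (cases "Suc t \<le> CARD('n)")
      case True
      then obtain j :: 'n where j: "position j = Suc t"
        using ex_position[where 'n='n and t="Suc t"] by auto
      with i position_le_iff[of i j] L have "v $ j \<le> v $ i" by simp
      then show ?thesis using i j coord_position by metis
    next
      case False
      then show ?thesis using L i coord_position[of v i] coord_outside[of "Suc t" v] by auto
    qed
  qed
next
  assume R: ?R
  have *: "coord v t \<le> coord v s" if "1 \<le> s" "s \<le> t" "t \<le> Suc CARD('n)" for s t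
    by (rule antimono_seqD[of 1 "Suc CARD('n)" "coord v"]) (use R that in auto)
  have "v $ j \<le> v $ i" if "i \<le> j" for i j
    using *[of "position i" "position j"] that position_range[of i] position_range[of j]
      position_le_iff[of i j] by simp
  moreover have "0 \<le> v $ i" for i
    using *[of "position i" "Suc CARD('n)"] position_range[of i] coord_outside[of "Suc CARD('n)" v]
    by simp
  ultimately show ?L by blast
qed

section \<open>Partial sums and the inequalities of the cone\<close>

abbreviation psum :: "real ^ 'n::{finite,linorder} \<Rightarrow> nat \<Rightarrow> real" where
  "psum v t \<equiv> (\<Sum>s=1..t. coord v s)"

lemma psum_add: "psum (u + v) t = psum u t + psum v t"
  by (simp add: sum.distrib)

lemma psum_diff: "psum (u - v) t = psum u t - psum v t"
  by (simp add: sum_subtractf)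

lemma psum_scaleR: "psum (c *\<^sub>R u) t = c * psum u t"
  by (simp add: sum_distrib_left)

text \<open>This form lists the inequalities of the cone as consecutive differences and differences
  of partial sums, the quantities whose vanishing decides tightness.\<close>

lemma Kostka_iff:
  fixes lam mu :: "real ^ 'n::{finite,linorder}"
  shows "(lam, mu) \<in> Kostka \<longleftrightarrow>
    (\<forall>t\<in>{1..CARD('n)}. coord lam (Suc t) \<le> coord lam t) \<and>
    (\<forall>t\<in>{1..CARD('n)}. coord mu (Suc t) \<le> coord mu t) \<and>
    (\<forall>t\<in>{1..CARD('n)}. psum mu t \<le> psum lam t) \<and>
    psum lam CARD('n) = psum mu CARD('n)"
proof -
  \<comment> \<open>The equality of the total sums supplies the inequality at
    \<open>t = CARD('n)\<close>.\<close>
  have "(\<forall>t\<in>{1..CARD('n) - 1}. psum mu t \<le> psum lam t) \<longleftrightarrow>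
      (\<forall>t\<in>{1..CARD('n)}. psum mu t \<le> psum lam t)"
    if eq: "psum lam CARD('n) = psum mu CARD('n)"
  proof
    assume *: "\<forall>t\<in>{1..CARD('n) - 1}. psum mu t \<le> psum lam t"
    show "\<forall>t\<in>{1..CARD('n)}. psum mu t \<le> psum lam t"
    proof
      fix t assume "t \<in> {1..CARD('n)}"
      then show "psum mu t \<le> psum lam t"
        using * eq by (cases "t = CARD('n)") auto
    qed
  qed auto
  then have "(\<forall>t\<in>{1..CARD('n) - 1}. psum mu t \<le> psum lam t) \<and> psum lam CARD('n) = psum mu CARD('n) \<longleftrightarrow>
      (\<forall>t\<in>{1..CARD('n)}. psum mu t \<le> psum lam t) \<and> psum lam CARD('n) = psum mu CARD('n)"
    by argo
  then show ?thesis
    unfolding Kostka_def coord_antimono_iff[symmetric] sum_coord_UNIV[OF order_refl, symmetric]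
      sum_coord[symmetric] mem_Collect_eq prod.case
    by (simp only: conj_assoc)
qed

text \<open>Since coordinates past \<open>CARD('n)\<close> are 0, the inequalities persist without
  an upper bound on \<open>t\<close>, which spares boundary cases later.\<close>

lemma KostkaD:
  fixes lam mu :: "real ^ 'n::{finite,linorder}"
  assumes "(lam, mu) \<in> Kostka"
  shows "\<And>t. 1 \<le> t \<Longrightarrow> coord lam (Suc t) \<le> coord lam t"
    and "\<And>t. 1 \<le> t \<Longrightarrow> coord mu (Suc t) \<le> coord mu t"
    and "\<And>t. psum mu t \<le> psum lam t"
    and "\<And>t. CARD('n) \<le> t \<Longrightarrow> psum lam t = psum mu t"
    and "\<And>t. 1 \<le> t \<Longrightarrow> 0 \<le> coord lam t"
    and "\<And>t. 1 \<le> t \<Longrightarrow> 0 \<le> coord mu t"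
proof -
  note K = assms[unfolded Kostka_iff]
  show lam: "coord lam (Suc t) \<le> coord lam t" if "1 \<le> t" for t
    using K that coord_outside[of t lam] coord_outside[of "Suc t" lam]
    by (cases "t \<le> CARD('n)") auto
  show mu: "coord mu (Suc t) \<le> coord mu t" if "1 \<le> t" for t
    using K that coord_outside[of t mu] coord_outside[of "Suc t" mu]
    by (cases "t \<le> CARD('n)") auto
  show top: "psum lam t = psum mu t" if "CARD('n) \<le> t" for t
    using K sum_coord_UNIV[OF that, of lam] sum_coord_UNIV[OF that, of mu]
      sum_coord_UNIV[OF order_refl, of lam] sum_coord_UNIV[OF order_refl, of mu] by metis
  show "psum mu t \<le> psum lam t" for t
  proof (cases "t \<le> CARD('n)")
    case True
    then show ?thesis using K by (cases "t = 0") auto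
  qed (use top in auto)
  show "0 \<le> coord lam t" if "1 \<le> t" for t
    using antimono_seqD[of t "t + CARD('n)" "coord lam" t "t + CARD('n)"] lam that
      coord_outside[of "t + CARD('n)" lam] by simp
  show "0 \<le> coord mu t" if "1 \<le> t" for t
    using antimono_seqD[of t "t + CARD('n)" "coord mu" t "t + CARD('n)"] mu that
      coord_outside[of "t + CARD('n)" mu] by simp
qed

lemma Kostka_scaleR: "x \<in> Kostka \<Longrightarrow> 0 \<le> c \<Longrightarrow> c *\<^sub>R x \<in> Kostka"
  by (cases x) (simp add: Kostka_iff mult_left_mono flip: sum_distrib_left)

lemma Kostka_zero: "0 \<in> Kostka"
  by (simp add: zero_prod_def Kostka_iff)

section \<open>The generators\<close>

text \<open>The bounds on the parameters keep both supports inside \<open>{1..CARD('n)}\<close>, so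
  the closed forms agree with the default value 0 beyond it.\<close>

lemma coord_ray_generator:
  assumes "a + l \<le> CARD('n)" "b \<le> a" "1 \<le> t"
    and "ray_generator (int a) (int b) (int l) = (u, v :: real ^ 'n::{finite,linorder})"
  shows "coord u t = (if t \<le> b + l then real a else 0)"
    and "coord v t = (if t \<le> l then real a else if t \<le> l + a then real b else 0)"
proof -
  have u: "u = (\<chi> i. if int (position i) \<le> int b + int l then of_int (int a) else 0)"
    and v: "v = (\<chi> i. if int (position i) \<le> int l then of_int (int a)
            else if int (position i) \<le> int l + int a then of_int (int b) else 0)"
    using assms(4) by (simp_all add: ray_generator_def)
  show "coord u t = (if t \<le> b + l then real a else 0)"
  proof (cases "t \<le> CARD('n)")
    case True
    then obtain i :: 'n where i: "position i = t"
      using \<open>1 \<le> t\<close> ex_position[where 'n='n and t=t] by auto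
    show ?thesis unfolding i[symmetric] coord_position u by auto
  qed (use assms coord_outside[of t u] in auto)
  show "coord v t = (if t \<le> l then real a else if t \<le> l + a then real b else 0)"
  proof (cases "t \<le> CARD('n)")
    case True
    then obtain i :: 'n where i: "position i = t"
      using \<open>1 \<le> t\<close> ex_position[where 'n='n and t=t] by auto
    show ?thesis unfolding i[symmetric] coord_position v by auto
  qed (use assms coord_outside[of t v] in auto)
qed

lemma psum_ray_generator:
  assumes "a + l \<le> CARD('n)" "b \<le> a"
    and "ray_generator (int a) (int b) (int l) = (u, v :: real ^ 'n::{finite,linorder})"
  shows "psum u t = real (a * min t (b + l))"
    and "psum v t = real (a * min t l + b * (min t (l + a) - l))"
proof -
  note c = coord_ray_generator[OF assms(1,2) _ assms(3)]
  show "psum u t = real (a * min t (b + l))"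
  proof (induction t)
    case (Suc t)
    then show ?case using c(1)[of "Suc t"]
      by (cases "Suc t \<le> b + l") (auto simp: min_absorb1 min_absorb2 algebra_simps)
  qed simp
  show "psum v t = real (a * min t l + b * (min t (l + a) - l))"
  proof (induction t)
    case (Suc t)
    \<comment> \<open>The new coordinate lies in the block of \<open>a\<close>, in the block of
      \<open>b\<close> or in the zeros. The truncated subtraction in the formula increases only in
      the middle case.\<close>
    consider "Suc t \<le> l" | "l \<le> t" "Suc t \<le> l + a" | "l + a \<le> t" by linarith
    then show ?case
    proof cases
      case 2
      then have "min (Suc t) (l + a) - l = Suc (min t (l + a) - l)" "min (Suc t) l = min t l" by auto
      moreover have "psum v (Suc t) = psum v t + b" using c(2)[of "Suc t"] 2 by simp
      ultimately show ?thesis unfolding Suc by (simp only: of_nat_add mult_Suc_right add_ac)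
    qed (use Suc c(2)[of "Suc t"] in \<open>auto simp: min_absorb1 min_absorb2 algebra_simps\<close>)
  qed simp
qed

text \<open>The difference of the partial sums is 0 up to \<open>l\<close>, rises with slope
  \<open>a - b\<close> for \<open>b\<close> steps, falls with slope \<open>-b\<close> for
  \<open>a - b\<close> steps, and is 0 from \<open>l + a\<close> on. For \<open>a = b\<close> it
  never leaves 0.\<close>

lemma psum_ray_generator_le:
  fixes u v :: "real ^ 'n::{finite,linorder}"
  assumes "a + l \<le> CARD('n)" "b \<le> a"
    and "ray_generator (int a) (int b) (int l) = (u, v)"
  shows "psum v t \<le> psum u t"
    and "t \<le> l \<or> l + a \<le> t \<or> a = b \<Longrightarrow> psum u t = psum v t"
proof -
  note p = psum_ray_generator[OF assms, of t]
  show "psum v t \<le> psum u t"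
  proof -
    consider "t \<le> l" | "l \<le> t" "t \<le> b + l" | "b + l \<le> t" "t \<le> l + a" | "l + a \<le> t" by linarith
    then have "a * min t l + b * (min t (l + a) - l) \<le> a * min t (b + l)"
    proof cases
      case 2
      then obtain d where "t = l + d" using le_Suc_ex by blast
      then show ?thesis using 2 \<open>b \<le> a\<close> by (simp add: min_def algebra_simps)
    next
      case 3
      then obtain d where "t = l + d" using le_Suc_ex[of l t] by auto
      then show ?thesis using 3 \<open>b \<le> a\<close> by (simp add: min_def algebra_simps)
    qed (use \<open>b \<le> a\<close> in \<open>simp_all add: min_def algebra_simps\<close>)
    then show ?thesis unfolding p of_nat_le_iff .
  qed
  assume "t \<le> l \<or> l + a \<le> t \<or> a = b"
  then have "a * min t (b + l) = a * min t l + b * (min t (l + a) - l)"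
  proof (elim disjE)
    assume "a = b"
    show ?thesis
    proof (cases "t \<le> l")
      case False
      then obtain d where "t = l + d" using le_Suc_ex[of l t] by auto
      then show ?thesis using \<open>a = b\<close> by (auto simp add: min_def algebra_simps)
    qed (use \<open>a = b\<close> in auto)
  qed (use \<open>b \<le> a\<close> in \<open>simp_all add: min_def algebra_simps\<close>)
  then show "psum u t = psum v t" unfolding p by simp
qed

lemma ray_generator_in_Kostka:
  assumes "a + l \<le> CARD('n)" "b \<le> a"
  shows "(ray_generator (int a) (int b) (int l) :: (real ^ 'n::{finite,linorder}) \<times> (real ^ 'n::{finite,linorder})) \<in> Kostka"
proof -
  obtain u v :: "real ^ 'n::{finite,linorder}" where g: "ray_generator (int a) (int b) (int l) = (u, v)"
    by (rule prod.exhaust)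
  note c = coord_ray_generator[OF assms _ g] and p = psum_ray_generator_le[OF assms g]
  show ?thesis
    unfolding g Kostka_iff using assms p by (auto simp: c simp del: sum.cl_ivl_Suc)
qed

section \<open>Rigidity of the generators\<close>

text \<open>Both sequences are constant on blocks and end in zeros. Equality of the partial sums at
  \<open>l\<close> matches the first block of \<open>be\<close> with the value \<open>A\<close> of
  \<open>al\<close>; equality at \<open>l + a\<close> then gives \<open>b * A = a * B\<close> for
  the second block. Only \<open>A\<close> stays free.\<close>

lemma tight_imp_multiple_ray_generator:
  fixes al be :: "real ^ 'n::{finite,linorder}"
  assumes abl: "a + l \<le> CARD('n)" "b \<le> a" "0 < b"
    and al: "\<And>t. 1 \<le> t \<Longrightarrow> t \<noteq> b + l \<Longrightarrow> coord al t = coord al (Suc t)"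
    and be: "\<And>t. 1 \<le> t \<Longrightarrow> t \<noteq> l \<Longrightarrow> t \<noteq> l + a \<Longrightarrow> coord be t = coord be (Suc t)"
    and pl: "psum al l = psum be l" and pm: "psum al (l + a) = psum be (l + a)"
  shows "(al, be) = (coord al 1 / a) *\<^sub>R ray_generator (int a) (int b) (int l)"
proof -
  define A B where "A = coord al 1" and "B = coord be (Suc l)"
  have a0: "0 < a" using abl by simp
  have al1: "coord al t = A" if "1 \<le> t" "t \<le> b + l" for t
    unfolding A_def by (rule const_seqD[of 1 "b + l"]) (use al that in auto)
  have al0: "coord al t = 0" if "b + l < t" for t
    by (rule coord_eq_0I, rule al) (use that in auto)
  have be1: "coord be t = coord be 1" if "1 \<le> t" "t \<le> l" for t
    by (rule const_seqD[of 1 l]) (use be that in auto)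
  have beB: "coord be t = B" if "l < t" "t \<le> l + a" for t
    unfolding B_def by (rule const_seqD[of "Suc l" "l + a"]) (use be that in auto)
  have be0: "coord be t = 0" if "l + a < t" for t
    by (rule coord_eq_0I, rule be) (use that in auto)
  have "psum al l = (\<Sum>s=1..l. A)" using al1 by (intro sum.cong) auto
  moreover have "psum be l = (\<Sum>s=1..l. coord be 1)"
    by (rule sum.cong[OF refl], rule be1) simp_all
  \<comment> \<open>For \<open>l = 0\<close> this is void, but then the first block of
    \<open>be\<close> is empty.\<close>
  ultimately have "l * A = l * coord be 1" using pl by simp
  then have be1A: "coord be t = A" if "1 \<le> t" "t \<le> l" for t
    using be1[OF that] that by auto
  have "psum be (l + a) = psum be l + (\<Sum>s=l+1..l+a. coord be s)"
    by (rule sum.ub_add_nat) simp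
  also have "(\<Sum>s=l+1..l+a. coord be s) = (\<Sum>s=l+1..l+a. B)" using beB by (intro sum.cong) auto
  also have "\<dots> = a * B" by simp
  finally have "psum be (l + a) = psum be l + a * B" .
  moreover have "psum al (l + a) = psum al l + (\<Sum>s=l+1..l+a. coord al s)"
    by (rule sum.ub_add_nat) simp
  \<comment> \<open>\<open>al\<close> vanishes past \<open>b + l\<close>, so only \<open>b\<close>
    of the \<open>a\<close> terms survive.\<close>
  moreover have "(\<Sum>s=l+1..l+a. coord al s) = (\<Sum>s=l+1..l+b. A)"
    using al1 al0 abl by (intro sum.mono_neutral_cong_right) auto
  ultimately have "b * A = a * B" using pl pm by simp
  then have BA: "B = A / a * b" using a0 by (simp add: field_simps)
  obtain u v :: "real ^ 'n::{finite,linorder}" where g: "ray_generator (int a) (int b) (int l) = (u, v)"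
    by (rule prod.exhaust)
  note c = coord_ray_generator[OF abl(1,2) _ g]
  have "al = (A / a) *\<^sub>R u"
  proof (rule coord_eqI)
    fix t :: nat assume "1 \<le> t"
    then show "coord al t = coord ((A / a) *\<^sub>R u) t"
      using al1[of t] al0[of t] a0 by (auto simp: c not_le)
  qed
  moreover have "be = (A / a) *\<^sub>R v"
  proof (rule coord_eqI)
    fix t :: nat assume "1 \<le> t"
    then show "coord be t = coord ((A / a) *\<^sub>R v) t"
      using be1A[of t] beB[of t] be0[of t] a0 BA by (auto simp: c not_le)
  qed
  ultimately show ?thesis unfolding g A_def by simp
qed

text \<open>An inequality tight at the generator is tight for \<open>y + z\<close>. As
  \<open>y\<close> and \<open>z\<close> both satisfy it, it is tight for each, and the tight
  inequalities determine \<open>y\<close> up to a scalar.\<close>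

lemma summand_of_ray_generator:
  fixes y z :: "(real ^ 'n::{finite,linorder}) \<times> (real ^ 'n::{finite,linorder})"
  assumes abl: "a + l \<le> CARD('n)" "b \<le> a" "0 < b"
    and y: "y \<in> Kostka" and z: "z \<in> Kostka"
    and sum: "y + z = s *\<^sub>R ray_generator (int a) (int b) (int l)"
  shows "\<exists>c\<ge>0. y = c *\<^sub>R ray_generator (int a) (int b) (int l)"
proof -
  obtain y1 y2 where y12: "y = (y1, y2)" by (cases y)
  obtain z1 z2 where z12: "z = (z1, z2)" by (cases z)
  obtain u v :: "real ^ 'n::{finite,linorder}" where g: "ray_generator (int a) (int b) (int l) = (u, v)"
    by (rule prod.exhaust)
  have s1: "y1 + z1 = s *\<^sub>R u" and s2: "y2 + z2 = s *\<^sub>R v" using sum unfolding y12 z12 g by auto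
  have c1: "coord y1 t + coord z1 t = s * coord u t" for t using s1 by (metis coord_add coord_scaleR)
  have c2: "coord y2 t + coord z2 t = s * coord v t" for t using s2 by (metis coord_add coord_scaleR)
  have p1: "psum y1 t + psum z1 t = s * psum u t" for t using s1 by (metis psum_add psum_scaleR)
  have p2: "psum y2 t + psum z2 t = s * psum v t" for t using s2 by (metis psum_add psum_scaleR)
  note Y = KostkaD[OF y[unfolded y12]] and Z = KostkaD[OF z[unfolded z12]]
  note c = coord_ray_generator[OF abl(1,2) _ g] and p = psum_ray_generator_le[OF abl(1,2) g]
  have "y = (coord y1 1 / a) *\<^sub>R ray_generator (int a) (int b) (int l)"
    unfolding y12
  proof (rule tight_imp_multiple_ray_generator[OF abl])
    fix t :: nat assume t: "1 \<le> t" "t \<noteq> b + l"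
    then have "coord u t = coord u (Suc t)" by (auto simp: c)
    then show "coord y1 t = coord y1 (Suc t)"
      using c1[of t] c1[of "Suc t"] Y(1)[OF t(1)] Z(1)[OF t(1)] by simp
  next
    fix t :: nat assume t: "1 \<le> t" "t \<noteq> l" "t \<noteq> l + a"
    then have "coord v t = coord v (Suc t)" by (auto simp: c)
    then show "coord y2 t = coord y2 (Suc t)"
      using c2[of t] c2[of "Suc t"] Y(2)[OF t(1)] Z(2)[OF t(1)] by simp
  next
    have *: "psum y1 t = psum y2 t" if "psum u t = psum v t" for t
    proof -
      have "psum y1 t + psum z1 t = psum y2 t + psum z2 t"
        unfolding p1 p2 that ..
      then show ?thesis using Y(3)[of t] Z(3)[of t] by linarith
    qed
    show "psum y1 l = psum y2 l" "psum y1 (l + a) = psum y2 (l + a)"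
      by (rule *, rule p(2), simp)+
  qed
  moreover have "0 \<le> coord y1 1 / a" using Y(5)[of 1] by simp
  ultimately show ?thesis by blast
qed

section \<open>Faces\<close>

text \<open>A nonzero \<open>x\<close> is the midpoint of 0 and \<open>2 *\<^sub>R x\<close>, which
  both lie in the cone.\<close>

lemma zero_in_face_of_Kostka:
  assumes "F face_of Kostka" "x \<in> F"
  shows "0 \<in> F"
proof (cases "x = 0")
  case False
  have x: "x \<in> Kostka" using assms face_of_imp_subset by blast
  have "x \<in> open_segment 0 (2 *\<^sub>R x)"
    using False by (auto simp: in_segment intro!: exI[of _ "1/2"])
  then show ?thesis using face_ofD[OF assms(1) _ Kostka_zero Kostka_scaleR[OF x] assms(2)] by auto
qed (use assms in auto)

text \<open>The sum is the midpoint of \<open>2 *\<^sub>R y\<close> and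
  \<open>2 *\<^sub>R z\<close>, so the face contains \<open>2 *\<^sub>R y\<close>; convexity
  together with 0 brings it down to \<open>y\<close>. If \<open>y = z\<close> the open segment is
  empty, and halving the sum suffices.\<close>

lemma summand_in_face_of_Kostka:
  assumes F: "F face_of Kostka" and y: "y \<in> Kostka" and z: "z \<in> Kostka" and yz: "y + z \<in> F"
  shows "y \<in> F"
proof (cases "y = z")
  case True
  have "(1/2) *\<^sub>R 0 + (1/2) *\<^sub>R (y + z) \<in> F"
    using face_of_imp_convex[OF F] zero_in_face_of_Kostka[OF F yz] yz
    by (intro convexD) auto
  then show ?thesis using True by (simp flip: scaleR_2)
next
  case False
  have "y + z \<in> open_segment (2 *\<^sub>R y) (2 *\<^sub>R z)"
    using False by (auto simp: in_segment intro!: exI[of _ "1/2"])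
  then have "2 *\<^sub>R y \<in> F"
    using face_ofD[OF F _ Kostka_scaleR[OF y] Kostka_scaleR[OF z] yz] by auto
  then have "(1/2) *\<^sub>R 0 + (1/2) *\<^sub>R (2 *\<^sub>R y) \<in> F"
    using face_of_imp_convex[OF F] zero_in_face_of_Kostka[OF F yz]
    by (intro convexD) auto
  then show ?thesis by simp
qed

section \<open>One-dimensional sets and rays\<close>

text \<open>As 0 lies in \<open>F\<close>, affine and linear dimension agree, which leaves no room
  for two independent vectors.\<close>

lemma aff_dim_1_collinear:
  fixes F :: "'a::euclidean_space set"
  assumes "aff_dim F = 1" "0 \<in> F" "x \<in> F" "x \<noteq> 0" "y \<in> F"
  shows "\<exists>s. y = s *\<^sub>R x"
proof (rule ccontr)
  assume "\<nexists>s. y = s *\<^sub>R x"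
  then have "y \<notin> span {x}" by (auto simp: span_singleton)
  then have "independent {y, x}" "y \<noteq> x" using assms by (auto simp: independent_insert span_base)
  then have "card {y, x} \<le> dim F" using assms by (intro independent_card_le_dim) auto
  moreover have "aff_dim F = int (dim F)" using assms by (intro aff_dim_zero) (simp add: hull_inc)
  ultimately show False using assms \<open>y \<noteq> x\<close> by simp
qed

lemma aff_dim_ray:
  fixes g :: "'a::euclidean_space"
  assumes "g \<noteq> 0"
  shows "aff_dim {s *\<^sub>R g |s. 0 \<le> s} = 1"
proof -
  let ?F = "{s *\<^sub>R g |s. 0 \<le> s}"
  have 0: "0 \<in> ?F" by (auto intro!: exI[of _ "0::real"])
  have "span ?F = span {g}"
  proof (rule span_eq[THEN iffD2], intro conjI)
    show "?F \<subseteq> span {g}" by (auto simp: span_singleton)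
    have "g \<in> ?F" by (auto intro!: exI[of _ "1::real"])
    then show "{g} \<subseteq> span ?F" by (simp add: span_base)
  qed
  then have "dim ?F = dim {g}" by (rule span_eq_dim)
  then show ?thesis using aff_dim_zero[of ?F] hull_inc[OF 0] assms by simp
qed

lemma extremal_ray_ray_generator:
  assumes abl: "a + l \<le> CARD('n::{finite,linorder})" "b \<le> a" "0 < b"
  defines "g \<equiv> ray_generator (int a) (int b) (int l) :: (real ^ 'n::{finite,linorder}) \<times> (real ^ 'n::{finite,linorder})"
  shows "g \<noteq> 0" and "extremal_ray {s *\<^sub>R g |s. 0 \<le> s}"
proof -
  show g0: "g \<noteq> 0"
  proof
    assume "g = 0"
    \<comment> \<open>The first coordinate of the generator is \<open>a\<close>, because
      \<open>0 < b\<close> gives \<open>1 \<le> b + l\<close>.\<close>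
    then have "real a = 0"
      using coord_ray_generator(1)[OF abl(1,2), of 1 0 0] abl(3) by (simp add: g_def zero_prod_def)
    then show False using abl by simp
  qed
  have gK: "g \<in> Kostka" unfolding g_def by (rule ray_generator_in_Kostka[OF abl(1,2)])
  have "{s *\<^sub>R g |s. 0 \<le> s} face_of Kostka"
    unfolding face_of_def
  proof (intro conjI ballI impI)
    show "{s *\<^sub>R g |s. 0 \<le> s} \<subseteq> Kostka" using Kostka_scaleR[OF gK] by auto
    show "convex {s *\<^sub>R g |s. 0 \<le> s}"
    proof (rule convexI)
      fix x y and p q :: real
      assume "x \<in> {s *\<^sub>R g |s. 0 \<le> s}" "y \<in> {s *\<^sub>R g |s. 0 \<le> s}" and pq: "0 \<le> p" "0 \<le> q"
      then obtain s t where "x = s *\<^sub>R g" "y = t *\<^sub>R g" "0 \<le> s" "0 \<le> t" by auto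
      then have "p *\<^sub>R x + q *\<^sub>R y = (p * s + q * t) *\<^sub>R g" "0 \<le> p * s + q * t"
        using pq by (auto simp: scaleR_add_left)
      then show "p *\<^sub>R x + q *\<^sub>R y \<in> {s *\<^sub>R g |s. 0 \<le> s}" by blast
    qed
    fix x y w
    assume x: "x \<in> Kostka" and y: "y \<in> Kostka" and w: "w \<in> {s *\<^sub>R g |s. 0 \<le> s}"
      and seg: "w \<in> open_segment x y"
    obtain s where s: "w = s *\<^sub>R g" using w by blast
    obtain p where p: "0 < p" "p < 1" "w = (1 - p) *\<^sub>R x + p *\<^sub>R y"
      using seg by (auto simp: in_segment)
    \<comment> \<open>A convex combination is a sum of two points of the cone, so the result on
      summands applies. The weight \<open>q\<close> is kept general to serve both endpoints.\<close>
    have *: "x' \<in> {s *\<^sub>R g |s. 0 \<le> s}"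
      if x': "x' \<in> Kostka" and y': "y' \<in> Kostka" and q: "0 < q" "q < 1"
        and w': "w = q *\<^sub>R x' + (1 - q) *\<^sub>R y'" for x' y' and q :: real
    proof -
      have "q *\<^sub>R x' \<in> Kostka" "(1 - q) *\<^sub>R y' \<in> Kostka"
        using Kostka_scaleR[OF x', of q] Kostka_scaleR[OF y', of "1 - q"] q by simp_all
      moreover have "q *\<^sub>R x' + (1 - q) *\<^sub>R y' = s *\<^sub>R g" using s w' by simp
      ultimately obtain c where c: "0 \<le> c" "q *\<^sub>R x' = c *\<^sub>R g"
        using summand_of_ray_generator[OF abl] unfolding g_def by blast
      have "x' = (1 / q) *\<^sub>R (q *\<^sub>R x')" using \<open>0 < q\<close> by simp
      also have "\<dots> = (c / q) *\<^sub>R g" unfolding c(2) by simp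
      finally show ?thesis using c(1) \<open>0 < q\<close> by auto
    qed
    show "x \<in> {s *\<^sub>R g |s. 0 \<le> s}" by (rule *[OF x y, of "1 - p"]) (use p in auto)
    show "y \<in> {s *\<^sub>R g |s. 0 \<le> s}" by (rule *[OF y x, of p]) (use p in \<open>auto simp: add.commute\<close>)
  qed
  then show "extremal_ray {s *\<^sub>R g |s. 0 \<le> s}"
    unfolding extremal_ray_def using aff_dim_ray[OF g0] by blast
qed

section \<open>Splitting off a generator\<close>

text \<open>Strict inequalities survive small \<open>e\<close> by continuity, and tight ones are
  undisturbed. Phrasing this as an eventual property lets several families share one
  \<open>e\<close>.\<close>

lemma eventually_small_multiple_le:
  fixes c d :: "'i \<Rightarrow> real"
  assumes "finite I" and "\<And>i. i \<in> I \<Longrightarrow> 0 \<le> c i" and "\<And>i. i \<in> I \<Longrightarrow> c i = 0 \<Longrightarrow> d i = 0"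
  shows "\<forall>\<^sub>F e in at_right 0. \<forall>i\<in>I. e * d i \<le> c i"
proof (rule eventually_ball_finite[OF assms(1)], rule ballI)
  fix i assume i: "i \<in> I"
  show "\<forall>\<^sub>F e in at_right 0. e * d i \<le> c i"
  proof (cases "c i = 0")
    case False
    then have "0 < c i" using assms(2)[OF i] by simp
    moreover have "((\<lambda>e. e * d i) \<longlongrightarrow> 0 * d i) (at_right 0)" by (intro tendsto_intros)
    ultimately have "\<forall>\<^sub>F e in at_right 0. e * d i < c i" by (intro order_tendstoD) auto
    then show ?thesis by eventually_elim simp
  qed (use assms(3)[OF i] in simp)
qed

text \<open>Without a descent \<open>lam\<close> would be 0, hence also \<open>mu\<close> by
  comparing totals. Without a descent of \<open>mu\<close> from \<open>k\<close> on,
  \<open>mu\<close> would vanish there, so \<open>lam\<close> would have reached its total before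
  \<open>k\<close>, contradicting its descent at \<open>k\<close>.\<close>

lemma ex_descents:
  fixes lam mu :: "real ^ 'n::{finite,linorder}"
  assumes K: "(lam, mu) \<in> Kostka" and nz: "(lam, mu) \<noteq> 0"
  obtains l k m where "l < k" "k \<le> m" "m \<le> CARD('n)"
    and "coord lam k \<noteq> coord lam (Suc k)"
    and "coord mu m \<noteq> coord mu (Suc m)"
    and "l = 0 \<or> coord mu l \<noteq> coord mu (Suc l)"
    and "\<And>t. l < t \<Longrightarrow> t < m \<Longrightarrow> coord mu t = coord mu (Suc t)"
proof -
  note D = KostkaD[OF K]
  have "\<exists>k\<ge>1. coord lam k \<noteq> coord lam (Suc k)"
  proof (rule ccontr)
    assume "\<not> ?thesis"
    then have *: "coord lam t = 0" if "1 \<le> t" for t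
      using that by (intro coord_eq_0I) (meson le_trans)
    then have "psum lam CARD('n) = 0" by (intro sum.neutral) auto
    then have "psum mu CARD('n) = 0" using D(4)[of "CARD('n)"] by simp
    then have "\<forall>t\<in>{1..CARD('n)}. coord mu t = 0"
      using D(6) by (subst (asm) sum_nonneg_eq_0_iff) auto
    then have "lam = 0" "mu = 0" using * by (auto intro!: coord_eqI)
    then show False using nz by (simp add: zero_prod_def)
  qed
  then obtain k where k: "1 \<le> k" "coord lam k \<noteq> coord lam (Suc k)" by blast
  have ex: "\<exists>m\<ge>k. coord mu m \<noteq> coord mu (Suc m)"
  proof (rule ccontr)
    assume "\<not> ?thesis"
    then have *: "coord mu t = 0" if "k \<le> t" for t
      using that by (intro coord_eq_0I) (meson le_trans)
    \<comment> \<open>The index \<open>k + CARD('n)\<close> is beyond both \<open>k\<close> and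
      \<open>CARD('n)\<close>, so no comparison of the two is required.\<close>
    have "psum lam k \<le> psum lam (k + CARD('n))"
      using D(5) by (intro sum_mono2) auto
    also have "\<dots> = psum mu (k + CARD('n))" by (rule D(4)) simp
    also have "\<dots> = psum mu (k - 1)" using * by (intro sum.mono_neutral_right) auto
    also have "\<dots> \<le> psum lam (k - 1)" by (rule D(3))
    finally have "psum lam k \<le> psum lam (k - 1)" .
    moreover have "psum lam k = psum lam (k - 1) + coord lam k"
      using k(1) by (cases k) auto
    ultimately show False using D(1)[OF k(1)] D(5)[of "Suc k"] k(2) by simp
  qed
  define m where "m = (LEAST m. k \<le> m \<and> coord mu m \<noteq> coord mu (Suc m))"
  have m: "k \<le> m" "coord mu m \<noteq> coord mu (Suc m)"
    using LeastI_ex[of "\<lambda>m. k \<le> m \<and> coord mu m \<noteq> coord mu (Suc m)"] ex unfolding m_def by auto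
  have "m \<le> CARD('n)"
    using m(2) coord_outside[of m mu] coord_outside[of "Suc m" mu] by force
  \<comment> \<open>Including 0 makes the maximum exist and equal 0 when no descent of
    \<open>mu\<close> precedes \<open>k\<close>.\<close>
  define S where "S = {t. t < k \<and> (t = 0 \<or> coord mu t \<noteq> coord mu (Suc t))}"
  have S: "finite S" "0 \<in> S" using k(1) by (auto simp: S_def)
  define l where "l = Max S"
  have "l \<in> S" unfolding l_def using S by (intro Max_in) auto
  have "coord mu t = coord mu (Suc t)" if "l < t" "t < m" for t
  proof (cases "t < k")
    case True
    have "t \<notin> S" using Max_ge[OF S(1)] that(1) unfolding l_def by force
    then show ?thesis using True by (auto simp: S_def)
  next
    case False
    then show ?thesis using not_less_Least[OF that(2)[unfolded m_def]] by auto
  qed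
  then show ?thesis
    using that[of l k m] \<open>l \<in> S\<close> k m \<open>m \<le> CARD('n)\<close> by (auto simp: S_def)
qed

lemma psum_strict_between_descents:
  fixes lam mu :: "real ^ 'n::{finite,linorder}"
  assumes K: "(lam, mu) \<in> Kostka" and "l < k" "k < m"
    and k: "coord lam k \<noteq> coord lam (Suc k)"
    and const: "\<And>t. l < t \<Longrightarrow> t < m \<Longrightarrow> coord mu t = coord mu (Suc t)"
    and t: "l < t" "t < m"
  shows "psum lam t \<noteq> psum mu t"
proof
  assume eq: "psum lam t = psum mu t"
  note D = KostkaD[OF K]
  \<comment> \<open>The second difference of \<open>D\<close> at \<open>s\<close> is
    \<open>coord lam (Suc s) - coord lam s\<close>, hence at most 0. With \<open>D s = 0\<close> and
    nonnegative neighbours, all three quantities must vanish, so zeros spread one step each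
    way.\<close>
  have zero: "psum lam (s - 1) = psum mu (s - 1) \<and> psum lam (Suc s) = psum mu (Suc s) \<and>
      coord lam s = coord lam (Suc s)"
    if s: "l < s" "s < m" and e: "psum lam s = psum mu s" for s
  proof -
    have "psum v s = psum v (s - 1) + coord v s" "psum v (Suc s) = psum v s + coord v (Suc s)"
      for v :: "real ^ 'n::{finite,linorder}"
      using s by (cases s; simp)+
    note this[of lam] this[of mu]
    moreover have "coord lam (Suc s) \<le> coord lam s" using D(1) s by simp
    ultimately show ?thesis
      using D(3)[of "s - 1"] D(3)[of "Suc s"] const[OF s] e by linarith
  qed
  have "psum lam k = psum mu k"
  proof (cases "t \<le> k")
    case True
    \<comment> \<open>The premise is carried through the induction so that the walk from
      \<open>t\<close> to \<open>k\<close> stays where \<open>zero\<close> applies.\<close>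
    then have "k < m \<longrightarrow> psum lam k = psum mu k"
    proof (induction k rule: dec_induct)
      case (step n)
      then show ?case using zero[of n] t by auto
    qed (use eq in simp)
    then show ?thesis using \<open>k < m\<close> by simp
  next
    case False
    then have "k \<le> t" by simp
    then have "l < k \<longrightarrow> psum lam k = psum mu k"
    proof (induction k rule: inc_induct)
      case (step n)
      then show ?case using zero[of "Suc n"] t by auto
    qed (use eq in simp)
    then show ?thesis using \<open>l < k\<close> by simp
  qed
  then show False using zero[of k] \<open>l < k\<close> \<open>k < m\<close> k by blast
qed

lemma Kostka_split_ray_generator:
  fixes lam mu :: "real ^ 'n::{finite,linorder}"
  assumes K: "(lam, mu) \<in> Kostka" and nz: "(lam, mu) \<noteq> 0"
  obtains a b l and e :: real where "a + l \<le> CARD('n)" "b \<le> a" "0 < b" "0 < e"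
    and "(lam, mu) - e *\<^sub>R ray_generator (int a) (int b) (int l) \<in> Kostka"
proof -
  obtain l k m where lkm: "l < k" "k \<le> m" "m \<le> CARD('n)"
    and k: "coord lam k \<noteq> coord lam (Suc k)"
    and m: "coord mu m \<noteq> coord mu (Suc m)"
    and l: "l = 0 \<or> coord mu l \<noteq> coord mu (Suc l)"
    and const: "\<And>t. l < t \<Longrightarrow> t < m \<Longrightarrow> coord mu t = coord mu (Suc t)"
    using ex_descents[OF K nz] by blast
  \<comment> \<open>With these values \<open>u\<close> descends only at \<open>k\<close>, and
    \<open>v\<close> at most at \<open>l\<close> and \<open>m\<close>.\<close>
  define a b where "a = m - l" and "b = k - l"
  have abl: "a + l \<le> CARD('n)" "b \<le> a" "0 < b" and eqs: "k = b + l" "m = l + a"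
    using lkm by (auto simp: a_def b_def)
  obtain u v :: "real ^ 'n::{finite,linorder}" where g: "ray_generator (int a) (int b) (int l) = (u, v)"
    by (rule prod.exhaust)
  note D = KostkaD[OF K]
  note c = coord_ray_generator[OF abl(1,2) _ g] and p = psum_ray_generator_le[OF abl(1,2) g]
  have G: "(u, v) \<in> Kostka" using ray_generator_in_Kostka[OF abl(1,2)] unfolding g .
  have "\<forall>\<^sub>F e in at_right 0. \<forall>t\<in>{1..CARD('n)}.
      e * (coord u t - coord u (Suc t)) \<le> coord lam t - coord lam (Suc t)"
  proof (rule eventually_small_multiple_le)
    fix t assume "t \<in> {1..CARD('n)}" "coord lam t - coord lam (Suc t) = 0"
    then have "1 \<le> t" "t \<noteq> k" using k by auto
    then show "coord u t - coord u (Suc t) = 0" unfolding eqs by (auto simp: c)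
  qed (use D(1) in auto)
  moreover have "\<forall>\<^sub>F e in at_right 0. \<forall>t\<in>{1..CARD('n)}.
      e * (coord v t - coord v (Suc t)) \<le> coord mu t - coord mu (Suc t)"
  proof (rule eventually_small_multiple_le)
    fix t assume "t \<in> {1..CARD('n)}" "coord mu t - coord mu (Suc t) = 0"
    then have "1 \<le> t" "t \<noteq> l" "t \<noteq> m" using l m by auto
    then show "coord v t - coord v (Suc t) = 0" unfolding eqs by (auto simp: c)
  qed (use D(2) in auto)
  moreover have "\<forall>\<^sub>F e in at_right 0. \<forall>t\<in>{1..CARD('n)}.
      e * (psum u t - psum v t) \<le> psum lam t - psum mu t"
  proof (rule eventually_small_multiple_le)
    fix t assume "psum lam t - psum mu t = 0"
    \<comment> \<open>A tight partial sum strictly between \<open>l\<close> and \<open>m\<close>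
      forces \<open>k = m\<close>, that is \<open>a = b\<close>, where the partial sums of the
      generator agree everywhere.\<close>
    then have "\<not> (l < t \<and> t < m \<and> k < m)"
      using psum_strict_between_descents[OF K lkm(1) _ k const] by (auto simp only: right_minus_eq)
    then have "t \<le> l \<or> l + a \<le> t \<or> a = b" using eqs abl by auto
    then show "psum u t - psum v t = 0" using p(2) by simp
  qed (use D(3) in auto)
  moreover have "\<forall>\<^sub>F e in at_right 0. 0 < (e :: real)" by (rule eventually_at_right_less)
  ultimately have "\<forall>\<^sub>F e in at_right 0. 0 < e \<and> (lam, mu) - e *\<^sub>R (u, v) \<in> Kostka"
  proof eventually_elim
    case (elim e)
    have "psum lam CARD('n) - e * psum u CARD('n) = psum mu CARD('n) - e * psum v CARD('n)"
      using D(4)[OF order_refl] KostkaD(4)[OF G order_refl] by simp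
    moreover have "\<forall>t\<in>{1..CARD('n)}. psum mu t - e * psum v t \<le> psum lam t - e * psum u t"
      using elim(3) by (auto simp: right_diff_distrib simp del: sum.cl_ivl_Suc)
    ultimately show ?case
      using elim unfolding scaleR_Pair diff_Pair Kostka_iff psum_diff psum_scaleR coord_diff coord_scaleR
      by (auto simp: right_diff_distrib simp del: sum.cl_ivl_Suc)
  qed
  then obtain e where "0 < e" "(lam, mu) - e *\<^sub>R (u, v) \<in> Kostka"
    using eventually_happens'[OF trivial_limit_at_right_real] by blast
  then show ?thesis using that[OF abl] unfolding g by blast
qed

section \<open>Integral points on extremal rays\<close>

theorem theorem1p5:
  fixes lam mu :: "real ^ 'n::{finite,linorder}"
  assumes "(lam, mu) \<in> Kostka_int"
  shows "(\<exists>F. extremal_ray F \<and> (lam, mu) \<in> F - {0}) \<longleftrightarrow>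
    (\<exists>(a::int) (b::int) (l::int) (c::rat).
       int CARD('n) \<ge> a + l \<and> a + l \<ge> a \<and> a \<ge> b \<and> b > 0 \<and> c > 0 \<and>
       (lam, mu) = of_rat c *\<^sub>R ray_generator a b l)"
proof
  assume "\<exists>F. extremal_ray F \<and> (lam, mu) \<in> F - {0}"
  then obtain F where F: "F face_of Kostka" "aff_dim F = 1" and x: "(lam, mu) \<in> F" "(lam, mu) \<noteq> 0"
    unfolding extremal_ray_def by blast
  have K: "(lam, mu) \<in> Kostka" using assms by (simp add: Kostka_int_def)
  obtain a b l and e :: real where abl: "a + l \<le> CARD('n)" "b \<le> a" "0 < b" and e: "0 < e"
    and split: "(lam, mu) - e *\<^sub>R ray_generator (int a) (int b) (int l) \<in> Kostka"
    using Kostka_split_ray_generator[OF K x(2)] .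
  obtain u v :: "real ^ 'n::{finite,linorder}" where g: "ray_generator (int a) (int b) (int l) = (u, v)"
    by (rule prod.exhaust)
  have "(u, v) \<in> Kostka" using ray_generator_in_Kostka[OF abl(1,2)] unfolding g .
  then have eg: "e *\<^sub>R (u, v) \<in> Kostka" using e by (intro Kostka_scaleR) auto
  \<comment> \<open>The split multiple and the remainder are in the cone and add up to a point of
    the face.\<close>
  have "e *\<^sub>R (u, v) \<in> F"
    using summand_in_face_of_Kostka[OF F(1) eg split[unfolded g]] x(1) by (simp del: scaleR_Pair)
  then obtain s where s: "e *\<^sub>R (u, v) = s *\<^sub>R (lam, mu)"
    using aff_dim_1_collinear[OF F(2) zero_in_face_of_Kostka[OF F(1) x(1)] x] by blast
  have "(u, v) \<noteq> 0" using extremal_ray_ray_generator(1)[OF abl] unfolding g .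
  then have "s \<noteq> 0" using s e by (auto simp: zero_prod_def)
  define C where "C = e / s"
  have "(lam, mu) = (1 / s) *\<^sub>R (s *\<^sub>R (lam, mu))" using \<open>s \<noteq> 0\<close> by simp
  then have C: "(lam, mu) = C *\<^sub>R (u, v)" unfolding s[symmetric] C_def by simp
  have a0: "0 < a" using abl by simp
  have "coord u 1 = a" using coord_ray_generator(1)[OF abl(1,2) _ g, of 1] abl(3) by simp
  then have Ca: "coord lam 1 = C * a" using C by simp
  \<comment> \<open>Collinearity leaves the sign of the factor open; the nonnegative first
    coordinate of \<open>lam\<close> settles it.\<close>
  have "0 \<le> C" using KostkaD(5)[OF K, of 1] a0 unfolding Ca by (simp add: zero_le_mult_iff)
  moreover have "C \<noteq> 0" using C x(2) by (auto simp: zero_prod_def)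
  ultimately have "0 < C" by simp
  obtain i :: 'n where i: "position i = 1"
    using ex_position[where 'n='n and t=1] abl by auto
  \<comment> \<open>Integrality enters here: \<open>C * a\<close> is an integer, so \<open>C\<close>
    is rational.\<close>
  have "coord lam 1 \<in> \<int>"
    using assms coord_position[of lam i] unfolding i Kostka_int_def by auto
  then obtain n where n: "C * a = of_int n" unfolding Ca by (auto elim: Ints_cases)
  define c :: rat where "c = of_int n / of_nat a"
  have cC: "of_rat c = C" using n a0 by (simp add: c_def of_rat_divide field_simps)
  then have "0 < c" using \<open>0 < C\<close> by (metis zero_less_of_rat_iff)
  moreover have "(lam, mu) = of_rat c *\<^sub>R ray_generator (int a) (int b) (int l)"
    unfolding cC g by (rule C)
  ultimately show "\<exists>(a::int) (b::int) (l::int) (c::rat).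
       int CARD('n) \<ge> a + l \<and> a + l \<ge> a \<and> a \<ge> b \<and> b > 0 \<and> c > 0 \<and>
       (lam, mu) = of_rat c *\<^sub>R ray_generator a b l"
    using abl by (intro exI[of _ "int a"] exI[of _ "int b"] exI[of _ "int l"] exI[of _ c]) auto
next
  assume "\<exists>(a::int) (b::int) (l::int) (c::rat).
       int CARD('n) \<ge> a + l \<and> a + l \<ge> a \<and> a \<ge> b \<and> b > 0 \<and> c > 0 \<and>
       (lam, mu) = of_rat c *\<^sub>R ray_generator a b l"
  then obtain a b l :: int and c :: rat where
    abl: "a + l \<le> int CARD('n)" "0 \<le> l" "b \<le> a" "0 < b" and c: "0 < c"
    and x: "(lam, mu) = of_rat c *\<^sub>R ray_generator a b l" by auto
  \<comment> \<open>\<open>a + l \<ge> a\<close> has given \<open>0 \<le> l\<close>, so all three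
    integers are natural numbers and the ray of the generator serves as \<open>F\<close>.\<close>
  have "nat a + nat l \<le> CARD('n)" "nat b \<le> nat a" "0 < nat b" using abl by auto
  note ext = extremal_ray_ray_generator[OF this]
  have "int (nat a) = a" "int (nat b) = b" "int (nat l) = l" using abl by auto
  note ext = ext[unfolded this]
  have "(lam, mu) \<in> {s *\<^sub>R ray_generator a b l |s. 0 \<le> s} - {0}"
    using x c ext(1) by (auto intro!: exI[of _ "of_rat c :: real"])
  then show "\<exists>F. extremal_ray F \<and> (lam, mu) \<in> F - {0}" using ext(2) by blast
qed

end
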